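(* Let $\mathcal{T}=(t_{ijkl})\in\widehat{\mathcal{E}}_{4,3}$. Call a permutation $(i,j,k)$ of $(1,2,3)$ admissible if $$t_{iiij}t_{ijjj}=t_{iiik}t_{ikkk}=0,\qquad t_{jjjk}t_{jkkk}=1,$$ and suppose that an admissible permutation exists. Then $\mathcal{T}$ is positive semi-definite if and only if there is an admissible permutation $(i,j,k)$ for which one of the following conditions is satisfied. (a) $t_{iiij}=t_{ijjj}=t_{iiik}=t_{ikkk}=0$, and one of: (a$_1$) $t_{1123}=t_{1223}=t_{1233}=0$, $t_{jjkk}=1$ and $t_{iijj},t_{iikk}\in\{0,1\}$; (a$_2$) $t_{iijk}\in\{-1,1\}$, $t_{ijjk}=t_{ijkk}=0$ and $t_{1122}=t_{2233}=t_{1133}=1$; further, in the case $t_{iijk}t_{jjjk}=-1$, it is only required that $t_{ijjk}=t_{ijkk}=0$, $t_{jjkk}=1$ and $t_{iijj}+t_{iikk}\geq 1$ with $t_{iijj},t_{iikk}\in\{0,1\}$. (b) $t_{1123}=t_{1223}=t_{1233}=t_{ijjj}=t_{ikkk}=t_{iiik}=0$, $t_{iiij}\in\{-1,1\}$, $t_{iijj}=t_{jjkk}=1$ and $t_{iikk}\in\{0,1\}$. (c) $t_{ijjj}=t_{ikkk}=t_{ijjk}=t_{ijkk}=0$ and $t_{iijk}t_{iiij}t_{iiik}=t_{1122}=t_{2233}=t_{1133}=1$. (d) $t_{iiij}=t_{iiik}=0$ and $t_{ijjj}t_{ijkk}=t_{ikkk}t_{ijjk}=t_{ijjj}t_{i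kkk}t_{iijk}=t_{ikkk}t_{jjjk}t_{ijkk}=t_{ijjj}t_{jjjk}t_{ijjk}=t_{1122}=t_{2233}=t_{1133}=1$.
   Context: A 4th order 3-dimensional real tensor $\mathcal{T}=(t_{ijkl})_{i,j,k,l\in\{1,2,3\}}$ is symmetric if its entries are invariant under all permutations of the four indices (so, e.g., $t_{ijjk}$ denotes the common value of all entries whose index multiset is $\{i,j,j,k\}$). $\widehat{\mathcal{E}}_{4,3}$ is the set of symmetric 4th order 3-dimensional tensors all of whose entries lie in $\{-1,0,1\}$ and whose diagonal entries satisfy $t_{1111}=t_{2222}=t_{3333}=1$. For $x\in\mathbb{R}^3$ put $\mathcal{T}x^4=\sum_{i,j,k,l=1}^3 t_{ijkl}x_ix_jx_kx_l$. $\mathcal{T}$ is positive semi-definite if $\mathcal{T}x^4\ge 0$ for all $x\in\mathbb{R}^3$. *)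

theory Defs
  imports "HOL-Analysis.Analysis"
begin

(* The index set {1, 2, 3} is the numeral type 3, whose elements are 1, 2 and 3 (with 3 = 0). *)

type_synonym tensor43 = "3 \<Rightarrow> 3 \<Rightarrow> 3 \<Rightarrow> 3 \<Rightarrow> real"

(* s lists the four indices in positions 0..3; p ranges over all permutations of the positions. *)
definition symmetric_tensor :: "tensor43 \<Rightarrow> bool" where
  "symmetric_tensor t \<longleftrightarrow>
     (\<forall>(s :: nat \<Rightarrow> 3) p. p permutes {0..<4} \<longrightarrow>
        t (s (p 0)) (s (p 1)) (s (p 2)) (s (p 3)) = t (s 0) (s 1) (s 2) (s 3))"

definition E_hat :: "tensor43 set" where
  "E_hat = {t. symmetric_tensor t \<and> (\<forall>i j k l. t i j k l \<in> {-1, 0, 1}) \<and>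
               t 1 1 1 1 = 1 \<and> t 2 2 2 2 = 1 \<and> t 3 3 3 3 = 1}"

definition tensor_form :: "tensor43 \<Rightarrow> real ^ 3 \<Rightarrow> real" where
  "tensor_form t x =
     (\<Sum>i\<in>UNIV. \<Sum>j\<in>UNIV. \<Sum>k\<in>UNIV. \<Sum>l\<in>UNIV. t i j k l * x $ i * x $ j * x $ k * x $ l)"

definition psd_tensor :: "tensor43 \<Rightarrow> bool" where
  "psd_tensor t \<longleftrightarrow> (\<forall>x. tensor_form t x \<ge> 0)"

definition admissible :: "tensor43 \<Rightarrow> 3 \<Rightarrow> 3 \<Rightarrow> 3 \<Rightarrow> bool" where
  "admissible t i j k \<longleftrightarrow> distinct [i, j, k] \<and>
     t i i i j * t i j j j = 0 \<and> t i i i k * t i k k k = 0 \<and> t j j j k * t j k k k = 1"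

definition cond_a1 :: "tensor43 \<Rightarrow> 3 \<Rightarrow> 3 \<Rightarrow> 3 \<Rightarrow> bool" where
  "cond_a1 t i j k \<longleftrightarrow>
     t 1 1 2 3 = 0 \<and> t 1 2 2 3 = 0 \<and> t 1 2 3 3 = 0 \<and>
     t j j k k = 1 \<and> t i i j j \<in> {0, 1} \<and> t i i k k \<in> {0, 1}"

(* When t i i j k * t j j j k = -1, the requirement that all three entries t 1 1 2 2, t 2 2 3 3,
   t 1 1 3 3 be 1 is relaxed to the second disjunct. *)
definition cond_a2 :: "tensor43 \<Rightarrow> 3 \<Rightarrow> 3 \<Rightarrow> 3 \<Rightarrow> bool" where
  "cond_a2 t i j k \<longleftrightarrow>
     t i i j k \<in> {-1, 1} \<and> t i j j k = 0 \<and> t i j k k = 0 \<and>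
     ((t 1 1 2 2 = 1 \<and> t 2 2 3 3 = 1 \<and> t 1 1 3 3 = 1) \<or>
      (t i i j k * t j j j k = -1 \<and> t j j k k = 1 \<and> t i i j j + t i i k k \<ge> 1 \<and>
       t i i j j \<in> {0, 1} \<and> t i i k k \<in> {0, 1}))"

definition cond_a :: "tensor43 \<Rightarrow> 3 \<Rightarrow> 3 \<Rightarrow> 3 \<Rightarrow> bool" where
  "cond_a t i j k \<longleftrightarrow>
     t i i i j = 0 \<and> t i j j j = 0 \<and> t i i i k = 0 \<and> t i k k k = 0 \<and>
     (cond_a1 t i j k \<or> cond_a2 t i j k)"

definition cond_b :: "tensor43 \<Rightarrow> 3 \<Rightarrow> 3 \<Rightarrow> 3 \<Rightarrow> bool" where
  "cond_b t i j k \<longleftrightarrow>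
     t 1 1 2 3 = 0 \<and> t 1 2 2 3 = 0 \<and> t 1 2 3 3 = 0 \<and>
     t i j j j = 0 \<and> t i k k k = 0 \<and> t i i i k = 0 \<and>
     t i i i j \<in> {-1, 1} \<and> t i i j j = 1 \<and> t j j k k = 1 \<and> t i i k k \<in> {0, 1}"

definition cond_c :: "tensor43 \<Rightarrow> 3 \<Rightarrow> 3 \<Rightarrow> 3 \<Rightarrow> bool" where
  "cond_c t i j k \<longleftrightarrow>
     t i j j j = 0 \<and> t i k k k = 0 \<and> t i j j k = 0 \<and> t i j k k = 0 \<and>
     t i i j k * t i i i j * t i i i k = 1 \<and>
     t 1 1 2 2 = 1 \<and> t 2 2 3 3 = 1 \<and> t 1 1 3 3 = 1"

definition cond_d :: "tensor43 \<Rightarrow> 3 \<Rightarrow> 3 \<Rightarrow> 3 \<Rightarrow> bool" where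
  "cond_d t i j k \<longleftrightarrow>
     t i i i j = 0 \<and> t i i i k = 0 \<and>
     t i j j j * t i j k k = 1 \<and> t i k k k * t i j j k = 1 \<and>
     t i j j j * t i k k k * t i i j k = 1 \<and>
     t i k k k * t j j j k * t i j k k = 1 \<and>
     t i j j j * t j j j k * t i j j k = 1 \<and>
     t 1 1 2 2 = 1 \<and> t 2 2 3 3 = 1 \<and> t 1 1 3 3 = 1"

end

theory Submission
  imports Defs
begin

text \<open>
  Write the form as a quartic in \<open>x = x\<^sub>i\<close>, \<open>y = x\<^sub>j\<close>, \<open>z = x\<^sub>k\<close>; changing the sign of \<open>z\<close> we may
  take \<open>t\<^sub>j\<^sub>j\<^sub>j\<^sub>k = t\<^sub>j\<^sub>k\<^sub>k\<^sub>k = 1\<close>. Nonnegativity at \<open>(0, 1, -1)\<close> forces \<open>t\<^sub>j\<^sub>j\<^sub>k\<^sub>k = 1\<close>, so the part free of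
  \<open>x\<close> is \<open>(y + z)\<^sup>4\<close> and \<open>(0, 1, -1)\<close> is a zero. Minimality there kills the terms of order one and
  makes the part linear in \<open>x\<close> a multiple \<open>4 b x (y + z)\<^sup>3\<close>. The few remaining forms are
  excluded by evaluation at single points, or are visibly sums of squares.
\<close>

text \<open>\<open>a\<close>, \<open>b\<close>, \<open>c\<close>, \<open>d\<close> stand for
  \<open>t i i i j\<close>, \<open>t i j j j\<close>, \<open>t i i i k\<close>,
  \<open>t i k k k\<close>; \<open>p\<close>, \<open>q\<close>, \<open>r\<close> for the entries
  with two doubled indices; \<open>u\<close>, \<open>v\<close>, \<open>w\<close> for those with
  three distinct ones. The factors 4, 6, 12 count index arrangements. One letter \<open>e\<close>
  serves both \<open>t j j j k\<close> and \<open>t j k k k\<close>, since a product 1 makes these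
  entries equal.\<close>

definition ternary_quartic ::
  "real \<Rightarrow> real \<Rightarrow> real \<Rightarrow> real \<Rightarrow> real \<Rightarrow> real \<Rightarrow> real \<Rightarrow> real \<Rightarrow> real \<Rightarrow> real \<Rightarrow> real \<Rightarrow>
   real \<Rightarrow> real \<Rightarrow> real \<Rightarrow> real" where
  "ternary_quartic a b c d e p q r u v w x y z =
     x^4 + y^4 + z^4 + 4 * a * x^3 * y + 4 * b * x * y^3 + 4 * c * x^3 * z + 4 * d * x * z^3
     + 4 * e * (y^3 * z + y * z^3) + 6 * p * x^2 * y^2 + 6 * q * x^2 * z^2 + 6 * r * y^2 * z^2
     + 12 * u * x^2 * y * z + 12 * v * x * y^2 * z + 12 * w * x * y * z^2"

lemma ternary_quartic_neg_z:
  "ternary_quartic a b c d e p q r u v w x y (- z)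
   = ternary_quartic a b (- c) (- d) (- e) p q r (- u) (- v) w x y z"
  by (simp add: ternary_quartic_def algebra_simps)

subsection \<open>Necessary conditions\<close>

lemma ternary_quartic_nonneg_linear_part:
  assumes nonneg: "\<And>x y z. ternary_quartic a b c d 1 p q r u v w x y z \<ge> 0"
    and entries: "a \<in> {-1, 0, 1}" "b \<in> {-1, 0, 1}" "c \<in> {-1, 0, 1}" "d \<in> {-1, 0, 1}"
      "p \<in> {-1, 0, 1}" "q \<in> {-1, 0, 1}" "r \<in> {-1, 0, 1}"
      "u \<in> {-1, 0, 1}" "v \<in> {-1, 0, 1}" "w \<in> {-1, 0, 1}"
  shows "r = 1" "d = b" "v = b" "w = b"
proof -
  have "-1 \<le> x" "x \<le> 1" if "x \<in> {-1, 0, 1}" for x :: real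
    using that by auto
  note bounds = entries[THEN this(1)] entries[THEN this(2)]
  show r: "r = 1"
    using nonneg[of 0 1 "-1"] entries(7) by (auto simp: ternary_quartic_def)
  \<comment> \<open>The points \<open>(1, \<plusminus>10, \<mp>10)\<close> and \<open>(1, 100 \<plusminus> 5, -100)\<close> are, up to scaling, small perturbations of the
    zero \<open>(0, 1, -1)\<close>: the first pair tests the derivative in \<open>x\<close>, the second pair the mixed term
    of \<open>x\<close> and \<open>y + z\<close> in the Hessian.\<close>
  have "0 \<le> 1 + 40 * (a - c) + 600 * (p + q - 2 * u) + 4000 * (b - d + 3 * (w - v))"
    using nonneg[of 1 10 "-10"] by (simp add: ternary_quartic_def r algebra_simps)
  \<comment> \<open>The other terms total at most 1 + 80 + 2400 < 4000.\<close>
  then have "b - d + 3 * (w - v) > -1"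
    using bounds by argo
  moreover have "0 \<le> 1 - 40 * (a - c) + 600 * (p + q - 2 * u) - 4000 * (b - d + 3 * (w - v))"
    using nonneg[of 1 "-10" 10] by (simp add: ternary_quartic_def r algebra_simps)
  then have "b - d + 3 * (w - v) < 1"
    using bounds by argo
  \<comment> \<open>\<open>b - d\<close> is an integer of absolute value at most 2 and
    \<open>3 * (w - v)\<close> is a multiple of 3, so a sum strictly between -1 and 1 forces both to
    vanish.\<close>
  ultimately have "d = b \<and> w = v"
    using entries(2,4,9,10) by auto
  then have bd: "d = b" and vw: "w = v"
    by simp_all
  have "0 \<le> 626 + 420 * a - 400 * c + 66150 * p + 60000 * q - 126000 * u + 630500 * b - 630000 * v"
    using nonneg[of 1 105 "-100"] by (simp add: ternary_quartic_def r bd vw algebra_simps)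
  \<comment> \<open>Apart from \<open>630000 * (b - v)\<close> the terms total at most
    254096.\<close>
  then have "b - v > -1"
    using bounds by argo
  moreover have
    "0 \<le> 626 + 380 * a - 400 * c + 54150 * p + 60000 * q - 114000 * u - 570500 * b + 570000 * v"
    using nonneg[of 1 95 "-100"] by (simp add: ternary_quartic_def r bd vw algebra_simps)
  then have "b - v < 1"
    using bounds by argo
  ultimately show "v = b"
    using entries(2,9) by auto
  then show "d = b" "w = b"
    using bd vw by auto
qed

text \<open>Once the linear part is known, only \<open>a\<close>, \<open>b\<close>,
  \<open>c\<close>, \<open>p\<close>, \<open>q\<close>, \<open>u\<close> remain free. The
  alternatives are sorted by which of \<open>a\<close>, \<open>b\<close>, \<open>c\<close> vanish,
  and small integer points suffice to exclude all other coefficients.\<close>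

lemma ternary_quartic_nonneg_cases_pos:
  assumes nonneg: "\<And>x y z. ternary_quartic a b c d 1 p q r u v w x y z \<ge> 0"
    and entries: "a \<in> {-1, 0, 1}" "b \<in> {-1, 0, 1}" "c \<in> {-1, 0, 1}" "d \<in> {-1, 0, 1}"
      "p \<in> {-1, 0, 1}" "q \<in> {-1, 0, 1}" "r \<in> {-1, 0, 1}"
      "u \<in> {-1, 0, 1}" "v \<in> {-1, 0, 1}" "w \<in> {-1, 0, 1}"
    and ab: "a * b = 0" and cd: "c * d = 0"
  shows "r = 1 \<and> d = b \<and> v = b \<and> w = b \<and> p \<in> {0, 1} \<and> q \<in> {0, 1} \<and>
    (b = 0 \<and> a = 0 \<and> c = 0 \<and> (u = 0 \<or> p = 1 \<and> q = 1 \<or> u = -1 \<and> p + q \<ge> 1) \<or>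
     b = 0 \<and> a \<noteq> 0 \<and> c = 0 \<and> p = 1 \<and> u = 0 \<or>
     b = 0 \<and> a = 0 \<and> c \<noteq> 0 \<and> q = 1 \<and> u = 0 \<or>
     b = 0 \<and> a \<noteq> 0 \<and> c \<noteq> 0 \<and> p = 1 \<and> q = 1 \<and> u = a * c \<or>
     b \<noteq> 0 \<and> a = 0 \<and> c = 0 \<and> p = 1 \<and> q = 1 \<and> u = 1)"
proof -
  note lin = ternary_quartic_nonneg_linear_part[OF nonneg entries]
  note Q = ternary_quartic_def lin
  \<comment> \<open>The odd terms cancel in the sum of the two values, which is
    \<open>4 + 12 * p\<close>.\<close>
  have p: "p \<in> {0, 1}"
    using nonneg[of 1 1 0] nonneg[of 1 "-1" 0] entries(1,2,5) by (auto simp: Q)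
  have q: "q \<in> {0, 1}"
    using nonneg[of 1 0 1] nonneg[of 1 0 "-1"] entries(2,3,6) by (auto simp: Q)
  show ?thesis
  proof (cases "b = 0")
    case b: False
    have ac: "a = 0" "c = 0"
      using ab cd lin b by auto
    have "p = 1"
      using nonneg[of 1 1 0] nonneg[of 1 "-1" 0] entries(2) p b by (auto simp: Q ac)
    moreover have "q = 1"
      using nonneg[of 1 0 1] nonneg[of 1 0 "-1"] entries(2) q b by (auto simp: Q ac)
    \<comment> \<open>Where \<open>b * (y + z)^3\<close> is -8, the value is
      \<open>12 * u - 3\<close>.\<close>
    moreover have "u = 1"
      using nonneg[of 1 1 1] nonneg[of 1 "-1" "-1"] entries(2,8) b calculation
      by (auto simp: Q ac)
    ultimately show ?thesis
      using lin b ac by simp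
  next
    case b: True
    have p1: "p = 1" if "a \<noteq> 0"
      using nonneg[of 1 1 0] nonneg[of 1 "-1" 0] entries(1) p that by (auto simp: Q b)
    have q1: "q = 1" if "c \<noteq> 0"
      using nonneg[of 1 0 1] nonneg[of 1 0 "-1"] entries(3) q that by (auto simp: Q b)
    \<comment> \<open>The form is now x^4 + 4 x^3 (a y + c z) + 6 x^2 (p y^2 + q z^2 + 2 u y z) + (y
      + z)^4. The first four points have y + z = 0, so the last term vanishes, and bound
      \<open>u\<close> from above; the other three have y = z and bound it from below.\<close>
    note ev = nonneg[of 1 1 "-1"] nonneg[of 1 "-1" 1] nonneg[of 3 1 "-1"] nonneg[of 3 "-1" 1]
      nonneg[of 2 1 1] nonneg[of 3 1 1] nonneg[of 3 "-1" "-1"]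
    consider "a = 0" "c = 0" | "a \<noteq> 0" "c = 0" | "a = 0" "c \<noteq> 0" | "a \<noteq> 0" "c \<noteq> 0"
      by blast
    then show ?thesis
    proof cases
      case 1
      then have "u = 0 \<or> p = 1 \<and> q = 1 \<or> u = -1 \<and> p + q \<ge> 1"
        using p q entries(8) ev by (auto simp: Q b)
      then show ?thesis
        using lin b p q 1 by auto
    next
      case 2
      then have "u = 0"
        using p1 q entries(1,8) ev by (auto simp: Q b)
      then show ?thesis
        using lin b p1 q 2 by auto
    next
      case 3
      then have "u = 0"
        using q1 p entries(3,8) ev by (auto simp: Q b)
      then show ?thesis
        using lin b q1 p 3 by auto
    next
      case 4
      then have "u = a * c"
        using p1 q1 entries(1,3,8) ev by (auto simp: Q b)
      then show ?thesis
        using lin b q1 p1 4 by auto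
    qed
  qed
qed

text \<open>Replacing z by -z reduces \<open>e = -1\<close> to \<open>e = 1\<close> and flips the
  signs of \<open>c\<close>, \<open>d\<close>, \<open>u\<close>, \<open>v\<close>, whence the
  factors \<open>e\<close>.\<close>

lemma ternary_quartic_nonneg_cases:
  assumes nonneg: "\<And>x y z. ternary_quartic a b c d e p q r u v w x y z \<ge> 0"
    and entries: "a \<in> {-1, 0, 1}" "b \<in> {-1, 0, 1}" "c \<in> {-1, 0, 1}" "d \<in> {-1, 0, 1}"
      "p \<in> {-1, 0, 1}" "q \<in> {-1, 0, 1}" "r \<in> {-1, 0, 1}"
      "u \<in> {-1, 0, 1}" "v \<in> {-1, 0, 1}" "w \<in> {-1, 0, 1}"
    and e: "e \<in> {-1, 1}" and ab: "a * b = 0" and cd: "c * d = 0"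
  shows "r = 1 \<and> d = e * b \<and> v = e * b \<and> w = b \<and> p \<in> {0, 1} \<and> q \<in> {0, 1} \<and>
    (b = 0 \<and> a = 0 \<and> c = 0 \<and> (u = 0 \<or> p = 1 \<and> q = 1 \<or> u = - e \<and> p + q \<ge> 1) \<or>
     b = 0 \<and> a \<noteq> 0 \<and> c = 0 \<and> p = 1 \<and> u = 0 \<or>
     b = 0 \<and> a = 0 \<and> c \<noteq> 0 \<and> q = 1 \<and> u = 0 \<or>
     b = 0 \<and> a \<noteq> 0 \<and> c \<noteq> 0 \<and> p = 1 \<and> q = 1 \<and> u = a * c \<or>
     b \<noteq> 0 \<and> a = 0 \<and> c = 0 \<and> p = 1 \<and> q = 1 \<and> u = e)"
proof (cases "e = 1")
  case True
  with ternary_quartic_nonneg_cases_pos[OF nonneg[unfolded True] entries ab cd] show ?thesis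
    by simp
next
  case False
  then have e1: "e = -1"
    using e by auto
  have "ternary_quartic a b (- c) (- d) 1 p q r (- u) (- v) w x y z \<ge> 0" for x y z
    using nonneg[of x y "- z"] by (simp add: ternary_quartic_neg_z e1)
  moreover have "- x \<in> {-1, 0, 1}" if "x \<in> {-1, 0, 1}" for x :: real
    using that by auto
  moreover have "(- c) * (- d) = 0"
    using cd by simp
  ultimately have "r = 1 \<and> - d = b \<and> - v = b \<and> w = b \<and> p \<in> {0, 1} \<and> q \<in> {0, 1} \<and>
    (b = 0 \<and> a = 0 \<and> - c = 0 \<and> (- u = 0 \<or> p = 1 \<and> q = 1 \<or> - u = -1 \<and> p + q \<ge> 1) \<or>
     b = 0 \<and> a \<noteq> 0 \<and> - c = 0 \<and> p = 1 \<and> - u = 0 \<or>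
     b = 0 \<and> a = 0 \<and> - c \<noteq> 0 \<and> q = 1 \<and> - u = 0 \<or>
     b = 0 \<and> a \<noteq> 0 \<and> - c \<noteq> 0 \<and> p = 1 \<and> q = 1 \<and> - u = a * (- c) \<or>
     b \<noteq> 0 \<and> a = 0 \<and> - c = 0 \<and> p = 1 \<and> q = 1 \<and> - u = 1)"
    using entries ab by (intro ternary_quartic_nonneg_cases_pos)
  then show ?thesis
    unfolding e1 by auto
qed

subsection \<open>Sufficient conditions\<close>

text \<open>If the quadratic form p y^2 + q z^2 + 2 u y z is nonnegative, \<open>split\<close> is
  enough. For \<open>u = - e\<close> with one of \<open>p\<close>, \<open>q\<close> zero it is
  indefinite; completing the square in x^2 then adds a third of (y + e z)^2 to it, giving a perfect
  square up to a factor.\<close>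

lemma ternary_quartic_nonneg_a:
  assumes e: "e \<in> {-1, 1}"
    and "u = 0 \<and> p \<in> {0, 1} \<and> q \<in> {0, 1} \<or> u \<in> {-1, 1} \<and> p = 1 \<and> q = 1 \<or>
      u = - e \<and> p \<in> {0, 1} \<and> q \<in> {0, 1} \<and> p + q \<ge> 1"
  shows "ternary_quartic 0 0 0 0 e p q 1 u 0 0 x y z \<ge> 0"
proof -
  have split: "ternary_quartic 0 0 0 0 e p q 1 u 0 0 x y z
      = x^4 + 6 * x^2 * (p * y^2 + q * z^2 + 2 * u * y * z) + (y + e * z)^4"
    using e by (auto simp: ternary_quartic_def power2_eq_square power3_eq_cube
        power4_eq_xxxx algebra_simps)
  have square: "ternary_quartic 0 0 0 0 e p q 1 u 0 0 x y z
      = (x^2 - (y + e * z)^2)^2 + 2 * x^2 * ((y + e * z)^2 + 3 * (p * y^2 + q * z^2 + 2 * u * y * z))"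
  proof -
    have "x^4 + 6 * x^2 * f + s^4 = (x^2 - s^2)^2 + 2 * x^2 * (s^2 + 3 * f)" for f s
      by algebra
    then show ?thesis
      unfolding split .
  qed
  consider "u = 0" "p \<ge> 0" "q \<ge> 0" | "u \<in> {-1, 1}" "p = 1" "q = 1"
    | "u = - e" "p = 1" "q = 0" | "u = - e" "p = 0" "q = 1"
    using assms by fastforce
  then show ?thesis
  proof cases
    case 1
    then show ?thesis
      unfolding split by simp
  next
    case 2
    then have "p * y^2 + q * z^2 + 2 * u * y * z = (y + u * z)^2"
      by (auto simp: power2_eq_square algebra_simps)
    then show ?thesis
      unfolding split by simp
  next
    case 3
    then have "(y + e * z)^2 + 3 * (p * y^2 + q * z^2 + 2 * u * y * z) = (2 * y - e * z)^2"
      using e by (auto simp: power2_eq_square algebra_simps)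
    then show ?thesis
      unfolding square by simp
  next
    case 4
    then have "(y + e * z)^2 + 3 * (p * y^2 + q * z^2 + 2 * u * y * z) = (y - 2 * e * z)^2"
      using e by (auto simp: power2_eq_square algebra_simps)
    then show ?thesis
      unfolding square by simp
  qed
qed

text \<open>These are the first three terms of (x + s)^4. Each form with a nonzero \<open>a\<close>,
  \<open>b\<close> or \<open>c\<close> contains them for a suitable linear form s, and what remains
  is a sum of even powers.\<close>

lemma quartic_1_4_6_nonneg:
  fixes x s :: real
  shows "x^4 + 4 * x^3 * s + 6 * x^2 * s^2 \<ge> 0"
proof -
  have "x^4 + 4 * x^3 * s + 6 * x^2 * s^2 = (x^2 + 2 * x * s)^2 + 2 * (x * s)^2"
    by algebra
  then show ?thesis
    by simp
qed

lemma ternary_quartic_nonneg_b: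
  assumes "e \<in> {-1, 1}" "a \<in> {-1, 1}" "q \<ge> 0"
  shows "ternary_quartic a 0 0 0 e 1 q 1 0 0 0 x y z \<ge> 0"
proof -
  have "ternary_quartic a 0 0 0 e 1 q 1 0 0 0 x y z
      = (x^4 + 4 * x^3 * (a * y) + 6 * x^2 * (a * y)^2) + 6 * q * x^2 * z^2 + (y + e * z)^4"
    using assms(1,2) by (auto simp: ternary_quartic_def power2_eq_square power3_eq_cube
        power4_eq_xxxx algebra_simps)
  then show ?thesis
    using quartic_1_4_6_nonneg[of x "a * y"] assms(3) by simp
qed

lemma ternary_quartic_nonneg_c:
  assumes "e \<in> {-1, 1}" "a \<in> {-1, 1}" "c \<in> {-1, 1}"
  shows "ternary_quartic a 0 c 0 e 1 1 1 (a * c) 0 0 x y z \<ge> 0"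
proof -
  have "ternary_quartic a 0 c 0 e 1 1 1 (a * c) 0 0 x y z
      = (x^4 + 4 * x^3 * (a * y + c * z) + 6 * x^2 * (a * y + c * z)^2) + (y + e * z)^4"
    using assms by (auto simp: ternary_quartic_def power2_eq_square power3_eq_cube
        power4_eq_xxxx algebra_simps)
  then show ?thesis
    using quartic_1_4_6_nonneg[of x "a * y + c * z"] by simp
qed

text \<open>The roles are reversed here: b (y + e z) leads the truncated binomial and x is the
  second variable.\<close>

lemma ternary_quartic_nonneg_d:
  assumes "e \<in> {-1, 1}" "b \<in> {-1, 1}"
  shows "ternary_quartic 0 b 0 (e * b) e 1 1 1 e (e * b) b x y z \<ge> 0"
proof -
  have "ternary_quartic 0 b 0 (e * b) e 1 1 1 e (e * b) b x y z
      = x^4 + ((b * (y + e * z))^4 + 4 * (b * (y + e * z))^3 * x + 6 * (b * (y + e * z))^2 * x^2)"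
    using assms by (auto simp: ternary_quartic_def power2_eq_square power3_eq_cube
        power4_eq_xxxx algebra_simps)
  then show ?thesis
    using quartic_1_4_6_nonneg[of "b * (y + e * z)" x] by simp
qed

subsection \<open>Symmetric tensors\<close>

text \<open>Adjacent transpositions generate all permutations; as ordered rewrite rules they sort
  the indices of every entry.\<close>

lemma symmetric_tensor_swap:
  assumes "symmetric_tensor t"
  shows "t b a c d = t a b c d" "t a c b d = t a b c d" "t a b d c = t a b c d"
proof -
  define s where "s = (\<lambda>n::nat. if n = 0 then a else if n = 1 then b else if n = 2 then c else d)"
  have "t (s (Transposition.transpose m n 0)) (s (Transposition.transpose m n 1))
        (s (Transposition.transpose m n 2)) (s (Transposition.transpose m n 3))
      = t (s 0) (s 1) (s 2) (s 3)" if "m < 4" "n < 4" for m n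
    using assms permutes_swap_id[of m "{0..<4}" n] that unfolding symmetric_tensor_def by auto
  from this[of 0 1] this[of 1 2] this[of 2 3]
  show "t b a c d = t a b c d" "t a c b d = t a b c d" "t a b d c = t a b c d"
    by (simp_all add: s_def Transposition.transpose_def)
qed

lemma UNIV_3_distinct:
  fixes i j k :: 3
  assumes "distinct [i, j, k]"
  shows "UNIV = {i, j, k}"
proof -
  have "card {i, j, k} = CARD(3)"
    using assms by simp
  then show ?thesis
    by (metis card_subset_eq finite subset_UNIV)
qed

lemma tensor_form_eq_ternary_quartic:
  assumes t: "t \<in> E_hat" and ijk: "distinct [i, j, k]" and e: "t j k k k = t j j j k"
  shows "tensor_form t x = ternary_quartic (t i i i j) (t i j j j) (t i i i k) (t i k k k)
    (t j j j k) (t i i j j) (t i i k k) (t j j k k) (t i i j k) (t i j j k) (t i j k k)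
    (x $ i) (x $ j) (x $ k)"
proof -
  have sym: "symmetric_tensor t"
    using t by (simp add: E_hat_def)
  note swap = symmetric_tensor_swap[OF sym]
  have sum3: "sum f UNIV = f i + f j + f k" for f :: "3 \<Rightarrow> real"
    using ijk by (simp add: UNIV_3_distinct[OF ijk] add.assoc)
  have diag: "t l l l l = 1" for l
    using t exhaust_3[of l] by (auto simp: E_hat_def)
  show ?thesis
    unfolding tensor_form_def sum3 ternary_quartic_def
    by (simp add: swap diag e algebra_simps power2_eq_square power3_eq_cube power4_eq_xxxx)
qed

lemma psd_tensor_iff_ternary_quartic:
  assumes "t \<in> E_hat" "distinct [i, j, k]" "t j k k k = t j j j k"
  shows "psd_tensor t \<longleftrightarrow> (\<forall>x y z. ternary_quartic (t i i i j) (t i j j j) (t i i i k) (t i k k k)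
    (t j j j k) (t i i j j) (t i i k k) (t j j k k) (t i i j k) (t i j j k) (t i j k k) x y z \<ge> 0)"
proof -
  have "\<exists>X :: real^3. X $ i = x \<and> X $ j = y \<and> X $ k = z" for x y z
    using assms(2)
    by (intro exI[of _ "\<chi> l. if l = i then x else if l = j then y else z"]) auto
  then show ?thesis
    unfolding psd_tensor_def tensor_form_eq_ternary_quartic[OF assms] by metis
qed

text \<open>Relabelling the indices only permutes the three entries within each group, so literal
  indices can be traded for \<open>i\<close>, \<open>j\<close>, \<open>k\<close>.\<close>

lemma index_123:
  fixes i j k :: 3
  assumes "symmetric_tensor t" "distinct [i, j, k]"
  shows "(t 1 1 2 3 = 0 \<and> t 1 2 2 3 = 0 \<and> t 1 2 3 3 = 0) \<longleftrightarrow>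
      (t i i j k = 0 \<and> t i j j k = 0 \<and> t i j k k = 0)"
    and "(t 1 1 2 2 = 1 \<and> t 2 2 3 3 = 1 \<and> t 1 1 3 3 = 1) \<longleftrightarrow>
      (t i i j j = 1 \<and> t j j k k = 1 \<and> t i i k k = 1)"
  using assms(2) exhaust_3[of i] exhaust_3[of j] exhaust_3[of k]
  by (auto simp: symmetric_tensor_swap[OF assms(1)])

lemma cond_iff:
  fixes i j k :: 3
  assumes "symmetric_tensor t" "distinct [i, j, k]"
  shows "cond_a1 t i j k \<longleftrightarrow> t i i j k = 0 \<and> t i j j k = 0 \<and> t i j k k = 0 \<and>
      t j j k k = 1 \<and> t i i j j \<in> {0, 1} \<and> t i i k k \<in> {0, 1}"
    and "cond_a2 t i j k \<longleftrightarrow> t i i j k \<in> {-1, 1} \<and> t i j j k = 0 \<and> t i j k k = 0 \<and>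
      (t i i j j = 1 \<and> t j j k k = 1 \<and> t i i k k = 1 \<or>
       t i i j k * t j j j k = -1 \<and> t j j k k = 1 \<and> t i i j j + t i i k k \<ge> 1 \<and>
       t i i j j \<in> {0, 1} \<and> t i i k k \<in> {0, 1})"
    and "cond_b t i j k \<longleftrightarrow> t i i j k = 0 \<and> t i j j k = 0 \<and> t i j k k = 0 \<and>
      t i j j j = 0 \<and> t i k k k = 0 \<and> t i i i k = 0 \<and>
      t i i i j \<in> {-1, 1} \<and> t i i j j = 1 \<and> t j j k k = 1 \<and> t i i k k \<in> {0, 1}"
    and "cond_c t i j k \<longleftrightarrow> t i j j j = 0 \<and> t i k k k = 0 \<and> t i j j k = 0 \<and> t i j k k = 0 \<and>
      t i i j k * t i i i j * t i i i k = 1 \<and> t i i j j = 1 \<and> t j j k k = 1 \<and> t i i k k = 1"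
    and "cond_d t i j k \<longleftrightarrow> t i i i j = 0 \<and> t i i i k = 0 \<and>
      t i j j j * t i j k k = 1 \<and> t i k k k * t i j j k = 1 \<and>
      t i j j j * t i k k k * t i i j k = 1 \<and> t i k k k * t j j j k * t i j k k = 1 \<and>
      t i j j j * t j j j k * t i j j k = 1 \<and> t i i j j = 1 \<and> t j j k k = 1 \<and> t i i k k = 1"
  using index_123[OF assms] unfolding cond_a1_def cond_a2_def cond_b_def cond_c_def cond_d_def
  by metis+

theorem theorem3p8:
  fixes t :: tensor43
  assumes "t \<in> E_hat"
    and "\<exists>i j k. admissible t i j k"
  shows "psd_tensor t \<longleftrightarrow>
    (\<exists>i j k. admissible t i j k \<and>
       (cond_a t i j k \<or> cond_b t i j k \<or> cond_c t i j k \<or> cond_d t i j k))"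
proof -
  have sym: "symmetric_tensor t" and entries: "t i j k l \<in> {-1, 0, 1}" for i j k l
    using assms(1) by (auto simp: E_hat_def)
  note swap = symmetric_tensor_swap[OF sym]
  \<comment> \<open>A product 1 of entries in {-1, 0, 1} forces two equal signs.\<close>
  have adm: "distinct [i, j, k]" "t j k k k = t j j j k" "t j j j k \<in> {-1, 1}"
    "t i i i j * t i j j j = 0" "t i i i k * t i k k k = 0"
    if "admissible t i j k" for i j k
    using that entries[of j j j k] entries[of j k k k] by (auto simp: admissible_def)
  show ?thesis
  proof
    assume psd: "psd_tensor t"
    obtain i j k where ijk: "admissible t i j k"
      using assms(2) by blast
    note adm = adm[OF ijk]
    have perm: "t k k k j = t j k k k" "t k j j j = t j j j k" "t k k j j = t j j k k"
      "t i i k j = t i i j k" "t i k k j = t i j k k" "t i k j j = t i j j k"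
      by (simp_all add: swap)
    \<comment> \<open>Condition (b) singles out \<open>j\<close>. If \<open>t i i i k\<close> is the
      nonzero entry instead, it is met by the permutation (i, k, j).\<close>
    have ikj: "admissible t i k j"
      using ijk by (auto simp: admissible_def perm mult.commute[of "t j k k k"])
    note cond = cond_iff[OF sym adm(1)]
    have cond': "cond_b t i k j \<longleftrightarrow> t i i k j = 0 \<and> t i k k j = 0 \<and> t i k j j = 0 \<and>
      t i k k k = 0 \<and> t i j j j = 0 \<and> t i i i j = 0 \<and>
      t i i i k \<in> {-1, 1} \<and> t i i k k = 1 \<and> t k k j j = 1 \<and> t i i j j \<in> {0, 1}"
      using adm(1) by (intro cond_iff sym) auto
    note cases = ternary_quartic_nonneg_cases[OF
        psd[unfolded psd_tensor_iff_ternary_quartic[OF assms(1) adm(1,2)], rule_format]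
        entries entries entries entries entries entries entries entries entries entries adm(3,4,5)]
    then have common: "t j j k k = 1" "t i k k k = t j j j k * t i j j j"
      "t i j j k = t j j j k * t i j j j" "t i j k k = t i j j j"
      "t i i j j \<in> {0, 1}" "t i i k k \<in> {0, 1}"
      by blast+
    from cases consider
        (a) "t i j j j = 0" "t i i i j = 0" "t i i i k = 0"
          "t i i j k = 0 \<or> t i i j j = 1 \<and> t i i k k = 1 \<or>
            t i i j k = - t j j j k \<and> t i i j j + t i i k k \<ge> 1"
      | (b) "t i j j j = 0" "t i i i j \<noteq> 0" "t i i i k = 0" "t i i j j = 1" "t i i j k = 0"
      | (b') "t i j j j = 0" "t i i i j = 0" "t i i i k \<noteq> 0" "t i i k k = 1" "t i i j k = 0"
      | (c) "t i j j j = 0" "t i i i j \<noteq> 0" "t i i i k \<noteq> 0" "t i i j j = 1" "t i i k k = 1"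
          "t i i j k = t i i i j * t i i i k"
      | (d) "t i j j j \<noteq> 0" "t i i i j = 0" "t i i i k = 0" "t i i j j = 1" "t i i k k = 1"
          "t i i j k = t j j j k"
      by blast
    then have "cond_a t i j k \<or> cond_b t i j k \<or> cond_b t i k j \<or> cond_c t i j k \<or> cond_d t i j k"
    proof cases
      case a
      then have "cond_a t i j k"
        using common adm(3) entries[of i i j k] by (auto simp: cond_a_def cond)
      then show ?thesis
        by blast
    next
      case b
      then have "cond_b t i j k"
        using common entries[of i i i j] by (auto simp: cond)
      then show ?thesis
        by blast
    next
      case b'
      then have "cond_b t i k j"
        using common entries[of i i i k] by (auto simp: cond' perm)
      then show ?thesis
        by blast
    next
      case c
      then have "cond_c t i j k"
        using common entries[of i i i j] entries[of i i i k] by (auto simp: cond)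
      then show ?thesis
        by blast
    next
      case d
      then have "cond_d t i j k"
        using common adm(3) entries[of i j j j] by (auto simp: cond)
      then show ?thesis
        by blast
    qed
    then show "\<exists>i j k. admissible t i j k \<and>
       (cond_a t i j k \<or> cond_b t i j k \<or> cond_c t i j k \<or> cond_d t i j k)"
      using ijk ikj by blast
  next
    assume "\<exists>i j k. admissible t i j k \<and>
       (cond_a t i j k \<or> cond_b t i j k \<or> cond_c t i j k \<or> cond_d t i j k)"
    then obtain i j k where ijk: "admissible t i j k"
      and cond: "cond_a t i j k \<or> cond_b t i j k \<or> cond_c t i j k \<or> cond_d t i j k"
      by blast
    note adm = adm[OF ijk]
    note cond_iff = cond_iff[OF sym adm(1)]
    note psd_iff = psd_tensor_iff_ternary_quartic[OF assms(1) adm(1,2)]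
    from cond show "psd_tensor t"
    proof (elim disjE)
      assume "cond_a t i j k"
      then have "t i i i j = 0" "t i j j j = 0" "t i i i k = 0" "t i k k k = 0"
        "t j j k k = 1" "t i j j k = 0" "t i j k k = 0"
        and "t i i j k = 0 \<and> t i i j j \<in> {0, 1} \<and> t i i k k \<in> {0, 1} \<or>
          t i i j k \<in> {-1, 1} \<and> t i i j j = 1 \<and> t i i k k = 1 \<or>
          t i i j k = - t j j j k \<and> t i i j j \<in> {0, 1} \<and> t i i k k \<in> {0, 1} \<and>
          t i i j j + t i i k k \<ge> 1"
        using adm(3) by (auto simp: cond_a_def cond_iff)
      then show ?thesis
        using ternary_quartic_nonneg_a[OF adm(3)] unfolding psd_iff by simp
    next
      assume "cond_b t i j k"
      then have "t i j j j = 0" "t i k k k = 0" "t i i i k = 0" "t i i j k = 0" "t i j j k = 0"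
        "t i j k k = 0" "t i i j j = 1" "t j j k k = 1" "t i i i j \<in> {-1, 1}" "t i i k k \<ge> 0"
        by (auto simp: cond_iff)
      then show ?thesis
        using ternary_quartic_nonneg_b[OF adm(3)] unfolding psd_iff by simp
    next
      assume "cond_c t i j k"
      then have "t i j j j = 0" "t i k k k = 0" "t i j j k = 0" "t i j k k = 0"
        "t i i j j = 1" "t j j k k = 1" "t i i k k = 1"
        and prod: "t i i j k * t i i i j * t i i i k = 1"
        by (auto simp: cond_iff)
      moreover have "t i i i j \<in> {-1, 1}" "t i i i k \<in> {-1, 1}" "t i i j k = t i i i j * t i i i k"
        using prod entries[of i i i j] entries[of i i i k] by auto
      ultimately show ?thesis
        using ternary_quartic_nonneg_c[OF adm(3)] unfolding psd_iff by simp
    next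
      assume d: "cond_d t i j k"
      \<comment> \<open>Signs are their own inverses, so the products in (d) become equations
        expressing the coefficients through \<open>t i j j j\<close> and
        \<open>t j j j k\<close>.\<close>
      have inverse: "x \<in> {-1, 1} \<and> y = x" if "x * y = 1" "x \<in> {-1, 0, 1}" for x y :: real
        using that by auto
      have zeros: "t i i i j = 0" "t i i i k = 0"
        and ones: "t i i j j = 1" "t j j k k = 1" "t i i k k = 1"
        and prod: "t i j j j * t i k k k * t i i j k = 1"
        using d by (auto simp: cond_iff)
      have b: "t i j j j \<in> {-1, 1}" and w: "t i j k k = t i j j j"
        using inverse[OF _ entries, of i j j j] d by (auto simp: cond_iff)
      have v: "t i j j k = t j j j k * t i j j j"
        using d b adm(3) unfolding cond_iff by auto
      have d': "t i k k k = t j j j k * t i j j j"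
        using inverse[OF _ entries, of i k k k "t i j j k"] d unfolding cond_iff v[symmetric] by simp
      have "t i i j k = t j j j k"
        using prod b adm(3) unfolding d' by auto
      then show ?thesis
        using ternary_quartic_nonneg_d[OF adm(3) b] unfolding psd_iff zeros ones w v d' by simp
    qed
  qed
qed

end
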